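(* Let $m$ be a positive odd integer, let $s\ge1$, let $a_1,\dots,a_s\ge0$ be integers, put $a=\sum_{i=1}^s(a_i+1)$, and assume $n:=m-a\ge 1$. For each $i$ let $c_i\in\tfrac12\mathbb{Z}$ with $c_i-a_i/2\in\mathbb{Z}$ and let $A_i=\{c_i-a_i/2,\dots,c_i+a_i/2\}$ (the $a_i+1$ consecutive integers centered at $c_i$); assume $A_1,\dots,A_s$ are pairwise disjoint subsets of $\{1,\dots,n+1\}$. For an integer $k$ with $0\le k\le\min_i a_i$, let $G_k$ be the induced subgraph of $AR_{m,n}$ on the white cells $(i,j)$ with $k\le i\le 2m-k$ and $k\le j\le 2n-k$ (a translate of $AR_{m-k,n-k}$) that do not belong to any of the copies of $O_{k,\,a_i-k}$ centered at $(m,\;2c_i-2)$, $i=1,\dots,s$. (In particular $G_0$ is $AR_{m,n}$ with the cells $(m,2t-2)$, $t\in A_1\cup\dots\cup A_s$, deleted.) Then for every integer $k$ with $1\le k\le\min_i a_i$, $$\mathrm{M}(G_k)=2^{\binom{k+1}{2}(s+1)-k(m+1)}\,\mathrm{M}(G_0).$$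
   Context: For integers $M,N\ge 0$ let $B_{M,N}=\{0,1,\dots,2M\}\times\{0,1,\dots,2N\}$; an element $(i,j)$ (row $i$, column $j$) is a cell, black if $i+j$ is even and white if $i+j$ is odd. The Aztec rectangle graph $AR_{M,N}$ has as vertices the white cells of $B_{M,N}$, two cells $(i,j),(i',j')$ being adjacent iff $|i-i'|=|j-j'|=1$. For integers $K,L\ge0$ and $(x,y)\in\mathbb{Z}^2$ with $x+y+K+L$ odd, the copy of the odd Aztec rectangle $O_{K,L}$ centered at $(x,y)$ is the set of cells $\{(x+r,y+t): |r|\le K,\ |t|\le L,\ r+t\equiv K+L \pmod 2\}$; all its cells are white. $\mathrm{M}(G)$ denotes the number of perfect matchings of $G$ (equivalently, domino tilings of the dual region). In the paper the right-hand side is also written via the graph $R''(m,n;\cdot)$, which is $G_0$. *)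

theory Defs
  imports Complex_Main "HOL-Library.Disjoint_Sets"
begin

type_synonym cell = "int \<times> int"

text \<open>A finite simple graph is a pair of a vertex set and a set of two-element edges.\<close>

type_synonym 'v ugraph = "'v set \<times> 'v set set"

definition induced_subgraph :: "'v ugraph \<Rightarrow> 'v set \<Rightarrow> 'v ugraph" where
  "induced_subgraph G W = (fst G \<inter> W, {e \<in> snd G. e \<subseteq> W})"

definition perfect_matching :: "'v ugraph \<Rightarrow> 'v set set \<Rightarrow> bool" where
  "perfect_matching G P \<longleftrightarrow> P \<subseteq> snd G \<and> (\<forall>v \<in> fst G. \<exists>!e. e \<in> P \<and> v \<in> e)"

definition num_perfect_matchings :: "'v ugraph \<Rightarrow> nat" where
  "num_perfect_matchings G = card {P. perfect_matching G P}"

definition board :: "nat \<Rightarrow> nat \<Rightarrow> cell set" where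
  "board M N = {0..2 * int M} \<times> {0..2 * int N}"

definition white :: "cell \<Rightarrow> bool" where
  "white p \<longleftrightarrow> odd (fst p + snd p)"

definition cell_adj :: "cell \<Rightarrow> cell \<Rightarrow> bool" where
  "cell_adj p q \<longleftrightarrow> \<bar>fst p - fst q\<bar> = 1 \<and> \<bar>snd p - snd q\<bar> = 1"

definition aztec_rectangle :: "nat \<Rightarrow> nat \<Rightarrow> cell ugraph" where
  "aztec_rectangle M N =
     (let V = {p \<in> board M N. white p}
      in (V, {{p, q} | p q. p \<in> V \<and> q \<in> V \<and> cell_adj p q}))"

definition odd_aztec_rectangle :: "nat \<Rightarrow> nat \<Rightarrow> cell \<Rightarrow> cell set" where
  "odd_aztec_rectangle K L z =
     {(fst z + r, snd z + t) | r t.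
        \<bar>r\<bar> \<le> int K \<and> \<bar>t\<bar> \<le> int L \<and> (r + t) mod 2 = (int K + int L) mod 2}"

definition centered_block :: "real \<Rightarrow> nat \<Rightarrow> int set" where
  "centered_block c l = {t. c - real l / 2 \<le> of_int t \<and> of_int t \<le> c + real l / 2}"

text \<open>The graph \<open>G\<^sub>k\<close>. The floor only converts type: the centres \<open>c i\<close> are
  half-integers, so \<open>2 * c i - 2\<close> is an integer.\<close>

definition holey_rectangle ::
  "nat \<Rightarrow> nat \<Rightarrow> nat \<Rightarrow> (nat \<Rightarrow> nat) \<Rightarrow> (nat \<Rightarrow> real) \<Rightarrow> nat \<Rightarrow> cell ugraph" where
  "holey_rectangle m n s a c k =
     induced_subgraph (aztec_rectangle m n)
       ({int k .. 2 * int m - int k} \<times> {int k .. 2 * int n - int k}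
        - (\<Union>i \<in> {1..s}. odd_aztec_rectangle k (a i - k) (int m, \<lfloor>2 * c i - 2\<rfloor>)))"

end

theory Submission
  imports Defs "HOL-Library.FuncSet"
begin

text \<open>
  The argument is Ciucu's complementation, applied once for each passage from \<open>G\<^sub>k\<close> to
  \<open>G\<^sub>k\<^sub>+\<^sub>1\<close>. The edges of both graphs are covered by the same edge-disjoint 4-cycles, whose
  centres form the set \<open>cells k\<close>. A perfect matching assigns to each vertex the 4-cycle containing
  its edge; conversely a set \<open>X\<close> of corners can be matched inside a 4-cycle in 1 way if it is empty
  or an edge, in 2 ways if it is everything, and in no way otherwise. Replacing in every 4-cycle the
  set of matched corners by its complement turns assignments for \<open>G\<^sub>k\<close> into assignments for
  \<open>G\<^sub>k\<^sub>+\<^sub>1\<close>, because a vertex lies on as many 4-cycles as it belongs to graphs among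
  \<open>G\<^sub>k\<close>, \<open>G\<^sub>k\<^sub>+\<^sub>1\<close>. In each 4-cycle the weight changes by \<open>2 ^ (h - 1)\<close>, where \<open>h\<close> is the number
  of matched corners lying in the row of the centre. The total of the \<open>h\<close> is the number of vertices
  of \<open>G\<^sub>k\<close> in such rows, so the ratio of the two matching numbers is a power of 2 that does not
  depend on the matching.
\<close>

section \<open>Matchings and edge-disjoint cells\<close>

text \<open>Edges and vertices are separate arguments because one edge set \<open>E\<close> serves
  both whole graphs and also the sets of corners inside a single cell.\<close>

definition matchings :: "'v set set \<Rightarrow> 'v set \<Rightarrow> 'v set set set" where
  "matchings E W = {P. P \<subseteq> E \<and> (\<forall>e\<in>P. e \<subseteq> W) \<and> (\<forall>v\<in>W. \<exists>!e. e \<in> P \<and> v \<in> e)}"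

text \<open>The cycle is l-u-r-d, with \<open>l\<close>, \<open>r\<close> in the row of the centre.
  The empty set has 1 matching and its complement 2. An edge and the opposite edge, which is its
  complement, have 1 each. For one corner, three corners or an opposite pair both numbers are 0. The
  power of 2 is 1 for the empty set, 2 for an edge and 4 for the full set.\<close>

lemma matchings_four_cycle_complement:
  assumes d: "l \<noteq> r" "l \<noteq> u" "l \<noteq> d" "r \<noteq> u" "r \<noteq> d" "u \<noteq> d"
    and E: "E \<inter> Pow {l, r, u, d} = {{l, u}, {l, d}, {r, u}, {r, d}}"
    and X: "X \<subseteq> {l, r, u, d}"
  shows "2 * card (matchings E X) = 2 ^ card (X \<inter> {l, r}) * card (matchings E ({l, r, u, d} - X))"
proof -
  let ?B = "{{l, u}, {l, d}, {r, u}, {r, d}}"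
  have ne: "{l,u} \<noteq> {l,d}" "{l,u} \<noteq> {r,u}" "{l,u} \<noteq> {r,d}" "{l,d} \<noteq> {r,u}" "{l,d} \<noteq> {r,d}" "{r,u} \<noteq> {r,d}"
    using d by (auto simp: doubleton_eq_iff)
  \<comment> \<open>Membership becomes a propositional formula in four atoms, one per edge, so that
    each of the 16 sets \<open>X\<close> is a Boolean computation.\<close>
  have M: "P \<in> matchings E Y \<longleftrightarrow> P \<subseteq> ?B \<and>
     (({l,u} \<in> P \<longrightarrow> l \<in> Y \<and> u \<in> Y) \<and> ({l,d} \<in> P \<longrightarrow> l \<in> Y \<and> d \<in> Y) \<and>
      ({r,u} \<in> P \<longrightarrow> r \<in> Y \<and> u \<in> Y) \<and> ({r,d} \<in> P \<longrightarrow> r \<in> Y \<and> d \<in> Y)) \<and>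
     ((l \<in> Y \<longrightarrow> ({l,u} \<in> P) \<noteq> ({l,d} \<in> P)) \<and> (r \<in> Y \<longrightarrow> ({r,u} \<in> P) \<noteq> ({r,d} \<in> P)) \<and>
      (u \<in> Y \<longrightarrow> ({l,u} \<in> P) \<noteq> ({r,u} \<in> P)) \<and> (d \<in> Y \<longrightarrow> ({l,d} \<in> P) \<noteq> ({r,d} \<in> P)))"
    if Y: "Y \<subseteq> {l, r, u, d}" for P Y
  proof (cases "P \<subseteq> ?B")
    case False
    have "P \<subseteq> E \<inter> Pow {l, r, u, d}" if "P \<in> matchings E Y"
      using that Y by (auto simp: matchings_def)
    then show ?thesis using False E by auto
  next
    case True
    have "P \<subseteq> E" using True E by auto
    moreover have "(\<forall>e\<in>P. e \<subseteq> Y) \<longleftrightarrow> ({l,u} \<in> P \<longrightarrow> l \<in> Y \<and> u \<in> Y) \<and> ({l,d} \<in> P \<longrightarrow> l \<in> Y \<and> d \<in> Y) \<and>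
      ({r,u} \<in> P \<longrightarrow> r \<in> Y \<and> u \<in> Y) \<and> ({r,d} \<in> P \<longrightarrow> r \<in> Y \<and> d \<in> Y)"
      using True by blast
    moreover have
      "(\<exists>!e. e \<in> P \<and> l \<in> e) \<longleftrightarrow> ({l,u} \<in> P) \<noteq> ({l,d} \<in> P)"
      "(\<exists>!e. e \<in> P \<and> r \<in> e) \<longleftrightarrow> ({r,u} \<in> P) \<noteq> ({r,d} \<in> P)"
      "(\<exists>!e. e \<in> P \<and> u \<in> e) \<longleftrightarrow> ({l,u} \<in> P) \<noteq> ({r,u} \<in> P)"
      "(\<exists>!e. e \<in> P \<and> d \<in> e) \<longleftrightarrow> ({l,d} \<in> P) \<noteq> ({r,d} \<in> P)"
    proof -
      have l: "e \<in> P \<and> l \<in> e \<longleftrightarrow> e \<in> P \<and> (e = {l,u} \<or> e = {l,d})" for e using True d by auto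
      have r: "e \<in> P \<and> r \<in> e \<longleftrightarrow> e \<in> P \<and> (e = {r,u} \<or> e = {r,d})" for e using True d by auto
      have u: "e \<in> P \<and> u \<in> e \<longleftrightarrow> e \<in> P \<and> (e = {l,u} \<or> e = {r,u})" for e using True d by auto
      have v: "e \<in> P \<and> d \<in> e \<longleftrightarrow> e \<in> P \<and> (e = {l,d} \<or> e = {r,d})" for e using True d by auto
      \<comment> \<open>A corner has only two possible edges, so being covered exactly once is an
        exclusive or.\<close>
      have *: "(\<exists>!e. e \<in> P \<and> (e = x \<or> e = y)) \<longleftrightarrow> (x \<in> P) \<noteq> (y \<in> P)" if "x \<noteq> y" for x y
        using that by metis
      show "(\<exists>!e. e \<in> P \<and> l \<in> e) \<longleftrightarrow> ({l,u} \<in> P) \<noteq> ({l,d} \<in> P)"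
      "(\<exists>!e. e \<in> P \<and> r \<in> e) \<longleftrightarrow> ({r,u} \<in> P) \<noteq> ({r,d} \<in> P)"
      "(\<exists>!e. e \<in> P \<and> u \<in> e) \<longleftrightarrow> ({l,u} \<in> P) \<noteq> ({r,u} \<in> P)"
      "(\<exists>!e. e \<in> P \<and> d \<in> e) \<longleftrightarrow> ({l,d} \<in> P) \<noteq> ({r,d} \<in> P)"
        unfolding l r u v by (rule *, fact ne)+
    qed
    moreover have "(\<forall>v\<in>Y. Q v) \<longleftrightarrow> (l \<in> Y \<longrightarrow> Q l) \<and> (r \<in> Y \<longrightarrow> Q r) \<and> (u \<in> Y \<longrightarrow> Q u) \<and> (d \<in> Y \<longrightarrow> Q d)" for Q
      using Y by blast
    ultimately show ?thesis using True unfolding matchings_def mem_Collect_eq by simp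
  qed
  have P: "P = Q \<longleftrightarrow> ({l,u} \<in> P \<longleftrightarrow> {l,u} \<in> Q) \<and> ({l,d} \<in> P \<longleftrightarrow> {l,d} \<in> Q) \<and> ({r,u} \<in> P \<longleftrightarrow> {r,u} \<in> Q) \<and> ({r,d} \<in> P \<longleftrightarrow> {r,d} \<in> Q)"
    if "P \<subseteq> ?B" "Q \<subseteq> ?B" for P Q
    using that by (intro iffI) (simp, blast)
  have eqI: "matchings E Y = S" 
     if "Y \<subseteq> {l,r,u,d}" "S \<subseteq> Pow ?B" "\<And>P. P \<subseteq> ?B \<Longrightarrow> P \<in> matchings E Y \<longleftrightarrow> P \<in> S" for Y S
  proof (rule set_eqI)
    fix P
    show "P \<in> matchings E Y \<longleftrightarrow> P \<in> S"
    proof (cases "P \<subseteq> ?B")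
      case False
      then have "P \<notin> matchings E Y" using M[OF that(1)] by simp
      moreover have "P \<notin> S" using False that(2) by blast
      ultimately show ?thesis by simp
    qed (rule that(3))
  qed
  note simps = M P d d[symmetric] ne ne[symmetric]
  have e0: "matchings E {} = {{}}"
    by (rule eqI) (simp_all add: simps)
  have e1: "matchings E {l} = {}" "matchings E {r} = {}" "matchings E {u} = {}" "matchings E {d} = {}"
    by (rule eqI; simp add: simps; blast)+
  have e2: "matchings E {l,r} = {}" "matchings E {u,d} = {}" "matchings E {l,r,u} = {}" "matchings E {l,r,d} = {}"
       "matchings E {l,u,d} = {}" "matchings E {r,u,d} = {}"
    by (rule eqI; simp add: simps; blast)+
  have e3: "matchings E {l,u} = {{{l,u}}}" "matchings E {l,d} = {{{l,d}}}"
       "matchings E {r,u} = {{{r,u}}}" "matchings E {r,d} = {{{r,d}}}"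
    by (rule eqI; simp add: simps; blast)+
  have e4: "matchings E {l,r,u,d} = {{{l,u},{r,d}},{{l,d},{r,u}}}"
    by (rule eqI; simp add: simps; blast)
  have e4': "card (matchings E {l,r,u,d}) = 2"
    unfolding e4 using ne by (subst card_2_iff) (metis doubleton_eq_iff)
  have "\<forall>X \<in> Pow {l, r, u, d}. 2 * card (matchings E X) =
      2 ^ card (X \<inter> {l, r}) * card (matchings E ({l, r, u, d} - X))"
    by (simp add: Pow_insert insert_Diff_if d d[symmetric] e0 e1 e2 e3 e4')
  then show ?thesis using X by blast
qed

section \<open>Decomposition of matchings along edge-disjoint cells\<close>

text \<open>\<open>I c\<close> is the set of vertices that are matched by an edge of the cell \<open>c\<close>.\<close>

definition allotments :: "'c set \<Rightarrow> ('c \<Rightarrow> 'v set) \<Rightarrow> 'v set \<Rightarrow> ('c \<Rightarrow> 'v set) set" where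
  "allotments C K W =
     {I \<in> PiE C (\<lambda>c. Pow (K c)). \<forall>v. card {c \<in> C. v \<in> I c} = of_bool (v \<in> W)}"

lemma Union_matchings: "P \<in> matchings E W \<Longrightarrow> \<Union>P = W"
  by (auto simp: matchings_def)

lemma finite_matchings: "finite W \<Longrightarrow> finite (matchings E W)"
  by (rule finite_subset[of _ "Pow (Pow W)"]) (auto simp: matchings_def)

text \<open>\<open>allotments\<close> uses counts because these can be subtracted when complements
  are taken; the bijection below needs plain membership facts instead. Finiteness of
  \<open>C\<close> rules out the default cardinality 0 of infinite sets.\<close>

lemma allotmentsD:
  assumes "finite C" "I \<in> allotments C K W"
  shows "c \<in> C \<Longrightarrow> I c \<subseteq> K c" "c \<in> C \<Longrightarrow> I c \<subseteq> W" "v \<in> W \<Longrightarrow> \<exists>!c. c \<in> C \<and> v \<in> I c"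
proof -
  show "c \<in> C \<Longrightarrow> I c \<subseteq> K c" using assms by (auto simp: allotments_def)
  have *: "card {c \<in> C. v \<in> I c} = of_bool (v \<in> W)" for v using assms by (auto simp: allotments_def)
  show "I c \<subseteq> W" if "c \<in> C"
  proof
    fix v assume "v \<in> I c"
    then have "card {c \<in> C. v \<in> I c} \<noteq> 0" using assms that by auto
    then show "v \<in> W" using * by (auto simp: of_bool_def split: if_splits)
  qed
  assume "v \<in> W"
  then have "card {c \<in> C. v \<in> I c} = 1" using * by simp
  then obtain d where "{c \<in> C. v \<in> I c} = {d}" by (auto simp: card_1_singleton_iff)
  then have "c \<in> C \<and> v \<in> I c \<longleftrightarrow> c = d" for c by (simp add: set_eq_iff)
  then show "\<exists>!c. c \<in> C \<and> v \<in> I c" by simp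
qed

text \<open>Every edge of a matching lies in exactly one cell, so a matching is the same as its
  family of parts. Once the vertex sets \<open>I c\<close> covered by the parts are fixed, the parts
  can be chosen independently, whence the product.\<close>

lemma card_matchings_cells:
  assumes "finite C" and finK: "\<And>c. c \<in> C \<Longrightarrow> finite (K c)"
    and ex: "\<And>e. e \<in> E \<Longrightarrow> e \<subseteq> W \<Longrightarrow> \<exists>c\<in>C. e \<subseteq> K c"
    and uniq: "\<And>e c d. \<lbrakk>e \<in> E; c \<in> C; d \<in> C; e \<subseteq> K c; e \<subseteq> K d\<rbrakk> \<Longrightarrow> c = d"
  shows "card (matchings E W) = (\<Sum>I\<in>allotments C K W. \<Prod>c\<in>C. card (matchings E (I c)))"
proof -
  let ?F = "\<lambda>P. \<lambda>c\<in>C. {e \<in> P. e \<subseteq> K c}"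
  let ?A = "allotments C K W"
  let ?S = "\<lambda>I. PiE C (\<lambda>c. matchings E (I c))"
  \<comment> \<open>The allotment can be read off from the family \<open>g\<close>, so different
    allotments give disjoint sets of families and the cardinalities add up.\<close>
  have I_eq: "I = (\<lambda>c\<in>C. \<Union>(g c))" if "I \<in> ?A" "g \<in> ?S I" for I g
  proof
    fix c show "I c = (\<lambda>c\<in>C. \<Union>(g c)) c"
    proof (cases "c \<in> C")
      case True
      then have "g c \<in> matchings E (I c)" using that by auto
      then show ?thesis using Union_matchings True by fastforce
    next
      case False
      then show ?thesis using that by (auto simp: allotments_def)
    qed
  qed
  have "bij_betw ?F (matchings E W) (\<Union>I\<in>?A. ?S I)"
  proof (rule bij_betw_byWitness[where f' = "\<lambda>g. \<Union>c\<in>C. g c"])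
    show "\<forall>P\<in>matchings E W. (\<Union>c\<in>C. ?F P c) = P"
      using ex by (fastforce simp: matchings_def)
    show "\<forall>g\<in>(\<Union>I\<in>?A. ?S I). ?F (\<Union>c\<in>C. g c) = g"
    proof clarify
      fix I g assume I: "I \<in> ?A" and g: "g \<in> ?S I"
      have sub: "e \<in> E \<and> e \<subseteq> K c" if "c \<in> C" "e \<in> g c" for c e
      proof -
        have "g c \<in> matchings E (I c)" using g that by auto
        then show ?thesis using that allotmentsD(1)[OF assms(1) I that(1)] by (fastforce simp: matchings_def)
      qed
      \<comment> \<open>An edge of \<open>g d\<close> that lies in \<open>K c\<close> forces
        \<open>d = c\<close> by \<open>uniq\<close>; outside \<open>C\<close> both sides are
        \<open>undefined\<close>.\<close>
      show "?F (\<Union>c\<in>C. g c) = g"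
      proof
        fix c show "?F (\<Union>c\<in>C. g c) c = g c"
          using sub uniq g by (cases "c \<in> C") (auto, blast)
      qed
    qed
    show "?F ` matchings E W \<subseteq> (\<Union>I\<in>?A. ?S I)"
    proof clarify
      fix P assume P: "P \<in> matchings E W"
      let ?I = "\<lambda>c\<in>C. \<Union>{e \<in> P. e \<subseteq> K c}"
      have "card {c \<in> C. v \<in> ?I c} = of_bool (v \<in> W)" for v
      proof (cases "v \<in> W")
        case True
        then have "\<exists>!e. e \<in> P \<and> v \<in> e" using P by (simp add: matchings_def)
        then obtain e where e: "e \<in> P" "v \<in> e" "\<And>f. f \<in> P \<Longrightarrow> v \<in> f \<Longrightarrow> f = e"
          by (elim ex1E) blast
        have "e \<in> E" "e \<subseteq> W" using e(1) P by (auto simp: matchings_def)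
        then obtain c where c: "c \<in> C" "e \<subseteq> K c" using ex by blast
        have "d = c" if "d \<in> C" "v \<in> ?I d" for d
        proof -
          obtain f where "f \<in> P" "f \<subseteq> K d" "v \<in> f" using \<open>v \<in> ?I d\<close> \<open>d \<in> C\<close> by auto
          then show ?thesis using uniq[OF \<open>e \<in> E\<close> _ c(1) _ c(2)] e(3) that(1) by blast
        qed
        moreover have "v \<in> ?I c" using c e(1,2) by auto
        ultimately have "{c \<in> C. v \<in> ?I c} = {c}" using c(1) by blast
        then show ?thesis using True by simp
      next
        case False
        then have "{c \<in> C. v \<in> ?I c} = {}" using P by (auto simp: matchings_def)
        then show ?thesis using False by simp
      qed
      then have "?I \<in> ?A" by (auto simp: allotments_def)
      moreover have "{e \<in> P. e \<subseteq> K c} \<in> matchings E (?I c)" if "c \<in> C" for c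
      proof -
        have "\<exists>!f. f \<in> {e \<in> P. e \<subseteq> K c} \<and> v \<in> f" if v: "v \<in> e" "e \<in> P" "e \<subseteq> K c" for v e
        proof -
          have "v \<in> W" using v P by (auto simp: matchings_def)
          then have "\<exists>!f. f \<in> P \<and> v \<in> f" using P by (auto simp: matchings_def)
          then show ?thesis using v by blast
        qed
        then show ?thesis using that P by (auto simp: matchings_def)
      qed
      ultimately show "?F P \<in> (\<Union>I\<in>?A. ?S I)" by (intro UN_I[of ?I]) auto
    qed
    show "(\<lambda>g. \<Union>c\<in>C. g c) ` (\<Union>I\<in>?A. ?S I) \<subseteq> matchings E W"
    proof clarify
      fix I g assume I: "I \<in> ?A" and g: "g \<in> ?S I"
      have gM: "g c \<in> matchings E (I c)" if "c \<in> C" for c using g that by auto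
      have sub: "e \<in> E \<and> e \<subseteq> I c" if "c \<in> C" "e \<in> g c" for c e
        using gM[OF that(1)] that(2) by (auto simp: matchings_def)
      have cover: "\<exists>!e. e \<in> (\<Union>c\<in>C. g c) \<and> v \<in> e" if v: "v \<in> W" for v
      proof -
        obtain c where c: "c \<in> C" "v \<in> I c" "\<And>d. d \<in> C \<Longrightarrow> v \<in> I d \<Longrightarrow> d = c"
          using allotmentsD(3)[OF assms(1) I v] by (elim ex1E) blast
        have "\<exists>!e. e \<in> g c \<and> v \<in> e" using gM[OF c(1)] c(2) by (simp add: matchings_def)
        then obtain e where e: "e \<in> g c" "v \<in> e" "\<And>f. f \<in> g c \<Longrightarrow> v \<in> f \<Longrightarrow> f = e"
          by (elim ex1E) blast
        show ?thesis
        proof (rule ex1I[of _ e])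
          show "e \<in> (\<Union>c\<in>C. g c) \<and> v \<in> e" using c e by blast
          fix f assume "f \<in> (\<Union>c\<in>C. g c) \<and> v \<in> f"
          then obtain d where d: "d \<in> C" "f \<in> g d" "v \<in> f" by blast
          then have "v \<in> I d" using sub by blast
          then have "d = c" using c d by blast
          then show "f = e" using e d by blast
        qed
      qed
      show "(\<Union>c\<in>C. g c) \<in> matchings E W"
        unfolding matchings_def
      proof (intro CollectI conjI ballI)
        show "(\<Union>c\<in>C. g c) \<subseteq> E" using sub by blast
        show "e \<subseteq> W" if "e \<in> (\<Union>c\<in>C. g c)" for e
          using that sub allotmentsD(2)[OF assms(1) I] by blast
      qed (rule cover)
    qed
  qed
  then have "card (matchings E W) = card (\<Union>I\<in>?A. ?S I)" by (rule bij_betw_same_card)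
  also have "\<dots> = (\<Sum>I\<in>?A. card (?S I))"
  proof (rule card_UN_disjoint)
    have fin: "finite (PiE C (\<lambda>c. Pow (K c)))" using assms by (intro finite_PiE) auto
    show "finite ?A" by (rule finite_subset[OF _ fin]) (auto simp: allotments_def)
    show "\<forall>I\<in>?A. finite (?S I)"
    proof
      fix I assume I: "I \<in> ?A"
      have "finite (I c)" if "c \<in> C" for c
        using allotmentsD(1)[OF assms(1) I that] finK[OF that] finite_subset by blast
      then show "finite (?S I)" using assms(1) by (intro finite_PiE finite_matchings) auto
    qed
    show "\<forall>I\<in>?A. \<forall>J\<in>?A. I \<noteq> J \<longrightarrow> ?S I \<inter> ?S J = {}"
    proof (intro ballI impI equals0I)
      fix I J g assume "I \<in> ?A" "J \<in> ?A" "I \<noteq> J" "g \<in> ?S I \<inter> ?S J"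
      then show False using I_eq[of I g] I_eq[of J g] by simp
    qed
  qed
  also have "\<dots> = (\<Sum>I\<in>?A. \<Prod>c\<in>C. card (matchings E (I c)))"
    using assms(1) by (simp add: card_PiE)
  finally show ?thesis .
qed

text \<open>By \<open>deg\<close>, complementing in every cell exchanges the allotments for
  \<open>W\<close> and \<open>W'\<close>; \<open>loc\<close> compares the matching numbers cell by
  cell. The product of the local powers of 2 is the same for all allotments, so it leaves the
  sum.\<close>

lemma card_matchings_complementation:
  fixes H :: "'v set"
  assumes "finite C" and finK: "\<And>c. c \<in> C \<Longrightarrow> finite (K c)" and finW: "finite W"
    and exW: "\<And>e. e \<in> E \<Longrightarrow> e \<subseteq> W \<Longrightarrow> \<exists>c\<in>C. e \<subseteq> K c"
    and exW': "\<And>e. e \<in> E \<Longrightarrow> e \<subseteq> W' \<Longrightarrow> \<exists>c\<in>C. e \<subseteq> K c"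
    and uniq: "\<And>e c d. \<lbrakk>e \<in> E; c \<in> C; d \<in> C; e \<subseteq> K c; e \<subseteq> K d\<rbrakk> \<Longrightarrow> c = d"
    and deg: "\<And>v. card {c \<in> C. v \<in> K c} = of_bool (v \<in> W) + of_bool (v \<in> W')"
    and loc: "\<And>c X. \<lbrakk>c \<in> C; X \<subseteq> K c\<rbrakk> \<Longrightarrow>
       2 * card (matchings E X) = 2 ^ card (X \<inter> H) * card (matchings E (K c - X))"
  shows "2 ^ card C * card (matchings E W) = 2 ^ card (W \<inter> H) * card (matchings E W')"
proof -
  let ?A = "allotments C K W" and ?A' = "allotments C K W'"
  let ?co = "\<lambda>I. \<lambda>c\<in>C. K c - I c"
  have co: "?co I \<in> allotments C K U'"
    if I: "I \<in> allotments C K U" and deg: "\<And>v. card {c \<in> C. v \<in> K c} = of_bool (v \<in> U) + of_bool (v \<in> U')"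
    for I U U'
  proof -
    have "card {c \<in> C. v \<in> ?co I c} = of_bool (v \<in> U')" for v
    proof -
      have "{c \<in> C. v \<in> K c} = {c \<in> C. v \<in> I c} \<union> {c \<in> C. v \<in> ?co I c}"
        using allotmentsD(1)[OF assms(1) I] by auto
      moreover have "card ({c \<in> C. v \<in> I c} \<union> {c \<in> C. v \<in> ?co I c}) =
          card {c \<in> C. v \<in> I c} + card {c \<in> C. v \<in> ?co I c}"
        using assms(1) by (intro card_Un_disjoint) auto
      moreover have "card {c \<in> C. v \<in> I c} = of_bool (v \<in> U)" using I by (auto simp: allotments_def)
      ultimately show ?thesis using deg[of v] by simp
    qed
    then show ?thesis by (auto simp: allotments_def)
  qed
  have coco: "?co (?co I) = I" if I: "I \<in> allotments C K U" for I U
  proof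
    fix c show "?co (?co I) c = I c"
      using allotmentsD(1)[OF assms(1) I, of c] I by (cases "c \<in> C") (auto simp: allotments_def)
  qed
  \<comment> \<open>Double counting: each vertex of \<open>W\<close> lies in exactly one of the sets
    \<open>I c\<close>.\<close>
  have H: "(\<Sum>c\<in>C. card (I c \<inter> H)) = card (W \<inter> H)" if I: "I \<in> ?A" for I
  proof -
    have "(\<Sum>c\<in>C. card (I c \<inter> H)) = (\<Sum>c\<in>C. card {v \<in> W \<inter> H. v \<in> I c})"
      using allotmentsD(2)[OF assms(1) I] by (intro sum.cong refl arg_cong[of _ _ card]) auto
    also have "\<dots> = (\<Sum>v\<in>W \<inter> H. card {c \<in> C. v \<in> I c})"
      using assms(1) finW by (intro sum_multicount_gen[symmetric]) auto
    also have "\<dots> = (\<Sum>v\<in>W \<inter> H. 1)"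
      using I by (intro sum.cong) (auto simp: allotments_def)
    finally show ?thesis by simp
  qed
  \<comment> \<open>The factor \<open>2 ^ card C\<close> supplies the 2 that \<open>loc\<close> asks
    for in each cell.\<close>
  have "2 ^ card C * card (matchings E W) = (\<Sum>I\<in>?A. \<Prod>c\<in>C. 2 * card (matchings E (I c)))"
    by (subst card_matchings_cells[OF assms(1) finK exW uniq]) (simp_all add: sum_distrib_left prod.distrib)
  also have "\<dots> = (\<Sum>I\<in>?A. \<Prod>c\<in>C. 2 ^ card (I c \<inter> H) * card (matchings E (?co I c)))"
    by (intro sum.cong prod.cong refl) (simp add: loc allotmentsD(1)[OF assms(1)])
  also have "\<dots> = (\<Sum>I\<in>?A. 2 ^ card (W \<inter> H) * (\<Prod>c\<in>C. card (matchings E (?co I c))))"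
    by (intro sum.cong refl) (simp only: prod.distrib power_sum[symmetric] H)
  also have "\<dots> = 2 ^ card (W \<inter> H) * (\<Sum>I\<in>?A. \<Prod>c\<in>C. card (matchings E (?co I c)))"
    by (simp add: sum_distrib_left)
  also have "(\<Sum>I\<in>?A. \<Prod>c\<in>C. card (matchings E (?co I c))) = (\<Sum>I\<in>?A'. \<Prod>c\<in>C. card (matchings E (I c)))"
    by (rule sum.reindex_bij_witness[of _ ?co ?co])
      (use coco co[OF _ deg] co[of _ W' W] deg in \<open>auto simp: add.commute\<close>)
  also have "\<dots> = card (matchings E W')"
    by (rule card_matchings_cells[OF assms(1) finK exW' uniq, symmetric])
  finally show ?thesis .
qed

section \<open>The 4-cycles of a holey rectangle\<close>

text \<open>The edges range over the whole plane, so that the levels differ only in their vertex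
  sets.\<close>

definition grid_edges :: "cell set set" where
  "grid_edges = {{p, q} | p q. cell_adj p q}"

definition corners :: "cell \<Rightarrow> cell set" where
  "corners c = {(fst c, snd c - 1), (fst c, snd c + 1), (fst c - 1, snd c), (fst c + 1, snd c)}"

section \<open>Degree counts along a single row or column\<close>

lemma card_pair_Int: "x \<noteq> z \<Longrightarrow> card ({x, z} \<inter> A) = of_bool (x \<in> A) + of_bool (z \<in> A)"
  by (simp add: Int_insert_left)

text \<open>The points \<open>x - 1\<close> and \<open>x + 1\<close> are the candidate centres
  beside \<open>x\<close>. An inner \<open>x\<close> has both and lies in both intervals; an end
  point has one and lies only in the longer interval. \<open>k < N\<close> keeps the two ends
  distinct: a single point would have no centre.\<close>

lemma step_two_interval:
  fixes k x N :: int
  assumes "even (x + k)" "k < N"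
  shows "of_bool (k < x - 1 \<and> x - 1 < 2 * N - k) + of_bool (k < x + 1 \<and> x + 1 < 2 * N - k) =
    (of_bool (k \<le> x \<and> x \<le> 2 * N - k) + of_bool (k + 1 \<le> x \<and> x \<le> 2 * N - (k + 1)) :: nat)"
proof -
  have "x < k \<or> x = k \<or> k + 2 \<le> x \<and> x \<le> 2 * N - k - 2 \<or> x = 2 * N - k \<or> 2 * N - k < x"
    using assms by presburger
  then consider "x < k" | "x = k" | "k + 2 \<le> x" "x \<le> 2 * N - k - 2" | "x = 2 * N - k" | "2 * N - k < x"
    by blast
  then show ?thesis using assms(2) by cases simp_all
qed

text \<open>This is the count along a column through a hole, which grows by one at each end. The
  points at distance \<open>k + 1\<close> from \<open>N\<close> lie outside the old hole and inside
  the new one; they have one centre, at distance \<open>k + 2\<close>. The bound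
  \<open>2 * k + 2 < N\<close> puts that centre inside the boundary.\<close>

lemma step_two_interval_hole:
  fixes k x N :: int
  assumes "even (x + k)" "odd (x - N - k)" "2 * k + 2 < N" "0 \<le> k"
  shows "of_bool (k < x - 1 \<and> x - 1 < 2 * N - k \<and> \<not> \<bar>x - 1 - N\<bar> \<le> k) +
      of_bool (k < x + 1 \<and> x + 1 < 2 * N - k \<and> \<not> \<bar>x + 1 - N\<bar> \<le> k) =
    (of_bool (k \<le> x \<and> x \<le> 2 * N - k \<and> \<not> \<bar>x - N\<bar> \<le> k) +
      of_bool (k + 1 \<le> x \<and> x \<le> 2 * N - (k + 1) \<and> \<not> \<bar>x - N\<bar> \<le> k + 1) :: nat)"
proof -
  have "\<bar>x - N\<bar> \<le> k - 1 \<or> x = N + k + 1 \<or> x = N - k - 1 \<or> k + 3 \<le> \<bar>x - N\<bar>"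
    using assms(2) by presburger
  then consider "\<bar>x - N\<bar> \<le> k - 1" | "x = N + k + 1" | "x = N - k - 1" | "k + 3 \<le> \<bar>x - N\<bar>"
    by blast
  then show ?thesis
  proof cases
    case 4
    then have "\<not> \<bar>x - 1 - N\<bar> \<le> k" "\<not> \<bar>x + 1 - N\<bar> \<le> k" "\<not> \<bar>x - N\<bar> \<le> k" "\<not> \<bar>x - N\<bar> \<le> k + 1" by linarith+
    then show ?thesis using step_two_interval[OF assms(1), of N] assms(3,4) by simp
  qed (use assms(3,4) in auto)
qed

text \<open>At level 0 the hole \<open>h\<close> consists of every second cell of row
  \<open>m\<close> between the columns \<open>y h - a h\<close> and \<open>y h + a h\<close>. The
  assumption \<open>apart\<close> is disjointness of the blocks: distinct integers differ by at
  least 1, their columns by at least 2.\<close>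

locale aligned_holes =
  fixes m n s :: nat and a :: "nat \<Rightarrow> nat" and y :: "nat \<Rightarrow> int"
  assumes odd_m: "odd m"
    and par: "\<And>h. h \<in> {1..s} \<Longrightarrow> even (y h - int (a h))"
    and left: "\<And>h. h \<in> {1..s} \<Longrightarrow> int (a h) \<le> y h"
    and right: "\<And>h. h \<in> {1..s} \<Longrightarrow> y h + int (a h) \<le> 2 * int n"
    and apart: "\<And>h g. \<lbrakk>h \<in> {1..s}; g \<in> {1..s}; h \<noteq> g\<rbrakk> \<Longrightarrow> int (a h) + int (a g) + 2 \<le> \<bar>y h - y g\<bar>"
begin

text \<open>The parity condition in the definition of \<open>O\<^sub>k\<^sub>,\<^sub>a\<^sub>-\<^sub>k\<close> holds for every white cell, so it is
  omitted here. The parameter \<open>k\<close> is an integer to avoid truncated subtraction.\<close>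

definition vertices :: "int \<Rightarrow> cell set" where
  "vertices k = {(i, j). odd (i + j) \<and> k \<le> i \<and> i \<le> 2 * int m - k \<and> k \<le> j \<and> j \<le> 2 * int n - k \<and>
     \<not> (\<exists>h\<in>{1..s}. \<bar>i - int m\<bar> \<le> k \<and> \<bar>j - y h\<bar> \<le> int (a h) - k)}"

text \<open>Centres are black cells. One is dropped if its left and right corners lie in the same
  hole of level \<open>k\<close>; by parity this means that its upper and lower corners lie in that
  hole at level \<open>k + 1\<close>.\<close>

definition cells :: "int \<Rightarrow> cell set" where
  "cells k = {(i, j). odd (i + k) \<and> odd (j + k) \<and>
     k < i \<and> i < 2 * int m - k \<and> k < j \<and> j < 2 * int n - k \<and>
     \<not> (\<exists>h\<in>{1..s}. \<bar>i - int m\<bar> \<le> k \<and> \<bar>j - y h\<bar> < int (a h) - k)}"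

lemma finite_vertices: "finite (vertices k)"
  by (rule finite_subset[of _ "{k..2 * int m - k} \<times> {k..2 * int n - k}"]) (auto simp: vertices_def)

lemma finite_cells: "finite (cells k)"
  by (rule finite_subset[of _ "{k..2 * int m - k} \<times> {k..2 * int n - k}"]) (auto simp: cells_def)

lemma corner_parity:
  assumes "c \<in> cells k" "p \<in> corners c"
  shows "odd (fst p + k) \<Longrightarrow> fst c = fst p" "even (fst p + k) \<Longrightarrow> snd c = snd p"
  using assms by (auto simp: cells_def corners_def)

text \<open>One end of the edge is a left or right corner and gives the row of the centre; the other
  end is an upper or lower corner and gives its column.\<close>

lemma edge_in_unique_cell:
  assumes "e \<in> grid_edges" "c \<in> cells k" "d \<in> cells k" "e \<subseteq> corners c" "e \<subseteq> corners d"
  shows "c = d"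
proof -
  obtain p q where pq: "e = {p, q}" "cell_adj p q" using assms(1) by (auto simp: grid_edges_def)
  have "\<bar>fst p - fst q\<bar> = 1" using pq(2) by (simp add: cell_adj_def)
  then have "odd (fst p + k) \<longleftrightarrow> even (fst q + k)" by presburger
  moreover have "p \<in> corners c" "p \<in> corners d" "q \<in> corners c" "q \<in> corners d"
    using assms(4,5) pq by auto
  ultimately have "fst c = fst d" "snd c = snd d"
    using corner_parity[OF assms(2)] corner_parity[OF assms(3)] by metis+
  then show ?thesis by (rule prod_eqI)
qed

lemma cell_of_edge:
  assumes e: "e \<in> grid_edges" and "e \<subseteq> vertices k \<or> e \<subseteq> vertices (k + 1)"
  shows "\<exists>c\<in>cells k. e \<subseteq> corners c"
proof -
  \<comment> \<open>Up to exchanging the ends, \<open>p\<close> is the one in a row of centres. The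
    centre has the row of \<open>p\<close> and the column of \<open>q\<close>.\<close>
  have main: "\<exists>c\<in>cells k. {p, q} \<subseteq> corners c"
    if adj: "cell_adj p q" and pq: "{p, q} \<subseteq> vertices k \<or> {p, q} \<subseteq> vertices (k + 1)" and odd: "odd (fst p + k)" for p q
  proof -
    obtain i j where p: "p = (i, j)" by (cases p)
    obtain i' j' where q: "q = (i', j')" by (cases q)
    have c: "{p, q} \<subseteq> corners (i, j')"
      using adj by (auto simp: p q corners_def cell_adj_def abs_if split: if_splits)
    have ad: "\<bar>i - i'\<bar> = 1" "\<bar>j - j'\<bar> = 1" using adj by (auto simp: p q cell_adj_def)
    have "(i, j') \<in> cells k"
      using pq
    proof
      assume "{p, q} \<subseteq> vertices k"
      then have pk: "(i, j) \<in> vertices k" and qk: "(i', j') \<in> vertices k" by (auto simp: p q)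
      have oj: "odd (i + j)" using pk by (simp add: vertices_def)
      have "odd (i + k)" using odd p by simp
      moreover have "odd (j' + k)" using oj \<open>odd (i + k)\<close> ad by presburger
      moreover have "k < i \<and> i < 2 * int m - k"
      proof -
        have "k \<le> i" "i \<le> 2 * int m - k" using pk by (auto simp: vertices_def)
        then show ?thesis using \<open>odd (i + k)\<close> by presburger
      qed
      moreover have "k < j' \<and> j' < 2 * int n - k"
      proof -
        have "k \<le> j'" "j' \<le> 2 * int n - k" using qk by (auto simp: vertices_def)
        then show ?thesis using \<open>odd (j' + k)\<close> by presburger
      qed
      \<comment> \<open>If this centre were dropped, the hole of level \<open>k\<close> would
        contain \<open>p\<close>.\<close>
      moreover have "\<not> (\<bar>i - int m\<bar> \<le> k \<and> \<bar>j' - y h\<bar> < int (a h) - k)" if "h \<in> {1..s}" for h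
      proof
        assume "\<bar>i - int m\<bar> \<le> k \<and> \<bar>j' - y h\<bar> < int (a h) - k"
        then have "\<bar>i - int m\<bar> \<le> k" "\<bar>j - y h\<bar> \<le> int (a h) - k" using ad by linarith+
        then show False using pk that by (auto simp: vertices_def)
      qed
      ultimately show ?thesis by (auto simp: cells_def)
    next
      assume "{p, q} \<subseteq> vertices (k + 1)"
      then have pk: "(i, j) \<in> vertices (k + 1)" and qk: "(i', j') \<in> vertices (k + 1)" by (auto simp: p q)
      have oj: "odd (i + j)" using pk by (simp add: vertices_def)
      have "odd (i + k)" using odd p by simp
      moreover have "odd (j' + k)" using oj \<open>odd (i + k)\<close> ad by presburger
      moreover have "k < i \<and> i < 2 * int m - k" "k < j' \<and> j' < 2 * int n - k"
        using pk qk by (auto simp: vertices_def)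
      \<comment> \<open>At level \<open>k + 1\<close> the holes are taller and narrower, and it is
        \<open>q\<close> that would lie in one.\<close>
      moreover have "\<not> (\<bar>i - int m\<bar> \<le> k \<and> \<bar>j' - y h\<bar> < int (a h) - k)" if "h \<in> {1..s}" for h
      proof
        assume "\<bar>i - int m\<bar> \<le> k \<and> \<bar>j' - y h\<bar> < int (a h) - k"
        then have "\<bar>i' - int m\<bar> \<le> k + 1" "\<bar>j' - y h\<bar> \<le> int (a h) - (k + 1)" using ad by linarith+
        then show False using qk that by (auto simp: vertices_def)
      qed
      ultimately show ?thesis by (auto simp: cells_def)
    qed
    then show ?thesis using c by blast
  qed
  obtain p q where pq: "e = {p, q}" "cell_adj p q" using e by (auto simp: grid_edges_def)
  show ?thesis
  proof (cases "odd (fst p + k)")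
    case True
    then show ?thesis using main[of p q] pq assms(2) by simp
  next
    case False
    have "\<bar>fst p - fst q\<bar> = 1" using pq(2) by (simp add: cell_adj_def)
    then have "odd (fst q + k)" using False by presburger
    moreover have "cell_adj q p" using pq(2) by (auto simp: cell_adj_def)
    ultimately show ?thesis using main[of q p] pq assms(2) by (simp add: insert_commute)
  qed
qed

text \<open>This provides \<open>deg\<close>. The parity of its row decides whether the two
  candidate centres of a white cell are beside it or above and below it. From level \<open>k\<close>
  to \<open>k + 1\<close> the rectangle shrinks on all sides, while the holes get narrower and
  taller.\<close>

lemma corner_count:
  assumes k: "0 \<le> k" and ka: "\<And>h. h \<in> {1..s} \<Longrightarrow> k < int (a h)" and km: "2 * k + 2 < int m" and kn: "k < int n"
  shows "card {c \<in> cells k. v \<in> corners c} = of_bool (v \<in> vertices k) + of_bool (v \<in> vertices (k + 1))"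
proof -
  obtain i j where v: "v = (i, j)" by (cases v)
  have corner: "v \<in> corners (x, z) \<longleftrightarrow> (x = i \<and> (z = j - 1 \<or> z = j + 1)) \<or> (z = j \<and> (x = i - 1 \<or> x = i + 1))" for x z
    by (auto simp: v corners_def)
  consider "even (i + j)" | "odd (i + k)" "even (j + k)" | "even (i + k)" "odd (j + k)" by fastforce
  then show ?thesis
  proof cases
    case 1
    have "{c \<in> cells k. v \<in> corners c} = {}"
      using 1 by (auto simp: corner cells_def)
    then have "card {c \<in> cells k. v \<in> corners c} = 0" by (simp only: card.empty)
    then show ?thesis using 1 by (simp add: v vertices_def)
  next
    case 2
    have "{c \<in> cells k. v \<in> corners c} = {(i, j - 1), (i, j + 1)} \<inter> cells k"
      using 2 by (auto simp: corner cells_def)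
    also have "card \<dots> = of_bool ((i, j - 1) \<in> cells k) + of_bool ((i, j + 1) \<in> cells k)"
      by (rule card_pair_Int) simp
    also have "\<dots> = of_bool (v \<in> vertices k) + of_bool (v \<in> vertices (k + 1))"
    proof (cases "k < i \<and> i < 2 * int m - k")
      case False
      have "v \<notin> vertices k"
      proof
        assume "v \<in> vertices k"
        then have "k \<le> i" "i \<le> 2 * int m - k" by (auto simp: v vertices_def)
        then show False using 2 False by presburger
      qed
      moreover have "v \<notin> vertices (k + 1)" "(i, j - 1) \<notin> cells k" "(i, j + 1) \<notin> cells k"
        using False by (auto simp: v vertices_def cells_def)
      ultimately show ?thesis by simp
    next
      case row: True
      have oddij: "odd (i + j)" and odds: "odd (j - 1 + k)" "odd (j + 1 + k)" using 2 by presburger+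
      \<comment> \<open>As \<open>m\<close> is odd, \<open>i - m\<close> has the parity of
        \<open>k\<close>, so the distance \<open>k + 1\<close> does not occur.\<close>
      have ik: "\<bar>i - int m\<bar> \<le> k + 1 \<longleftrightarrow> \<bar>i - int m\<bar> \<le> k"
        using 2 odd_m by presburger
      show ?thesis
      proof (cases "\<exists>h\<in>{1..s}. \<bar>i - int m\<bar> \<le> k \<and> \<bar>j - y h\<bar> \<le> int (a h) - k")
        case True
        then obtain h where h: "h \<in> {1..s}" "\<bar>i - int m\<bar> \<le> k" "\<bar>j - y h\<bar> \<le> int (a h) - k" by blast
        \<comment> \<open>By \<open>apart\<close>, no second hole reaches \<open>v\<close> or the
          centres beside it.\<close>
        have other: "int (a g) - k < \<bar>z - y g\<bar>" if "g \<in> {1..s}" "g \<noteq> h" "\<bar>z - j\<bar> \<le> 1" for g z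
          using apart[OF h(1) that(1)] that h(3) k by linarith
        have red: "(\<exists>g\<in>{1..s}. \<bar>i - int m\<bar> \<le> k \<and> Q g) \<longleftrightarrow> Q h"
          if "\<And>g. g \<in> {1..s} \<Longrightarrow> g \<noteq> h \<Longrightarrow> \<not> Q g" for Q
          using that h(1,2) by blast
        have "v \<notin> vertices k" using True by (simp add: v vertices_def)
        moreover have "v \<in> vertices (k + 1) \<longleftrightarrow> k < j \<and> j < 2 * int n - k \<and> \<not> \<bar>j - y h\<bar> \<le> int (a h) - (k + 1)"
        proof -
          have "(\<exists>g\<in>{1..s}. \<bar>i - int m\<bar> \<le> k \<and> \<bar>j - y g\<bar> \<le> int (a g) - (k + 1)) \<longleftrightarrow> \<bar>j - y h\<bar> \<le> int (a h) - (k + 1)"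
            by (rule red) (use other[of _ j] in force)
          then show ?thesis unfolding v vertices_def ik mem_Collect_eq prod.case using row oddij by auto
        qed
        moreover have "(i, z) \<in> cells k \<longleftrightarrow> k < z \<and> z < 2 * int n - k \<and> \<not> \<bar>z - y h\<bar> < int (a h) - k"
          if z: "\<bar>z - j\<bar> \<le> 1" "odd (z + k)" for z
        proof -
          have "(\<exists>g\<in>{1..s}. \<bar>i - int m\<bar> \<le> k \<and> \<bar>z - y g\<bar> < int (a g) - k) \<longleftrightarrow> \<bar>z - y h\<bar> < int (a h) - k"
            by (rule red) (use other[OF _ _ z(1)] in force)
          then show ?thesis unfolding cells_def mem_Collect_eq prod.case using row 2 z by auto
        qed
        from this[of "j - 1"] this[of "j + 1"]
        have "(i, j - 1) \<in> cells k \<longleftrightarrow> k < j - 1 \<and> j - 1 < 2 * int n - k \<and> \<not> \<bar>j - 1 - y h\<bar> < int (a h) - k"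
          "(i, j + 1) \<in> cells k \<longleftrightarrow> k < j + 1 \<and> j + 1 < 2 * int n - k \<and> \<not> \<bar>j + 1 - y h\<bar> < int (a h) - k"
          using odds by auto
        moreover have bd: "k \<le> y h - (int (a h) - k)" "y h + (int (a h) - k) \<le> 2 * int n - k" "k < int (a h)"
          using left[OF h(1)] right[OF h(1)] ka[OF h(1)] by linarith+
        moreover have "even (j - y h - (int (a h) - k))" using par[OF h(1)] 2 by presburger
        \<comment> \<open>An end of the hole is regained at level \<open>k + 1\<close> and has the
          one centre outside the hole, unless the boundary excludes both. A cell further inside has
          no centre and stays removed.\<close>
        then have "j = y h + (int (a h) - k) \<or> j = y h - (int (a h) - k) \<or> \<bar>j - y h\<bar> \<le> int (a h) - k - 2"
          using h(3) by presburger
        then consider "j = y h + (int (a h) - k)" | "j = y h - (int (a h) - k)" | "\<bar>j - y h\<bar> \<le> int (a h) - k - 2"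
          by blast
        then have "(if k < j - 1 \<and> j - 1 < 2 * int n - k \<and> \<not> \<bar>j - 1 - y h\<bar> < int (a h) - k then 1 else 0) +
            (if k < j + 1 \<and> j + 1 < 2 * int n - k \<and> \<not> \<bar>j + 1 - y h\<bar> < int (a h) - k then 1 else 0) =
            (if k < j \<and> j < 2 * int n - k \<and> \<not> \<bar>j - y h\<bar> \<le> int (a h) - (k + 1) then 1 else (0::nat))"
        proof cases
          case 1
          then have "\<not> (\<not> \<bar>j - 1 - y h\<bar> < int (a h) - k)" "\<not> \<bar>j + 1 - y h\<bar> < int (a h) - k"
            "\<not> \<bar>j - y h\<bar> \<le> int (a h) - (k + 1)" "k < j"
            using bd by linarith+
          moreover have "j + 1 < 2 * int n - k \<longleftrightarrow> j < 2 * int n - k" using 2(2) by presburger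
          ultimately show ?thesis by auto
        next
          case 2
          then have "\<not> \<bar>j - 1 - y h\<bar> < int (a h) - k" "\<not> (\<not> \<bar>j + 1 - y h\<bar> < int (a h) - k)"
            "\<not> \<bar>j - y h\<bar> \<le> int (a h) - (k + 1)" "j < 2 * int n - k"
            using bd by linarith+
          moreover have "k < j - 1 \<longleftrightarrow> k < j" using \<open>even (j + k)\<close> by presburger
          ultimately show ?thesis by auto
        next
          case 3
          then have "\<bar>j - 1 - y h\<bar> < int (a h) - k" "\<bar>j + 1 - y h\<bar> < int (a h) - k"
            "\<bar>j - y h\<bar> \<le> int (a h) - (k + 1)"
            by linarith+
          then show ?thesis by auto
        qed
        ultimately show ?thesis by (simp only: of_bool_def simp_thms if_False add_0)
      next
        case False
        have "(i, z) \<in> cells k \<longleftrightarrow> k < z \<and> z < 2 * int n - k" if z: "\<bar>z - j\<bar> \<le> 1" "odd (z + k)" for z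
        proof -
          have "\<not> (\<exists>h\<in>{1..s}. \<bar>i - int m\<bar> \<le> k \<and> \<bar>z - y h\<bar> < int (a h) - k)"
            using False z(1) by force
          then show ?thesis unfolding cells_def mem_Collect_eq prod.case using row 2 z by auto
        qed
        from this[of "j - 1"] this[of "j + 1"]
        have "(i, j - 1) \<in> cells k \<longleftrightarrow> k < j - 1 \<and> j - 1 < 2 * int n - k"
          "(i, j + 1) \<in> cells k \<longleftrightarrow> k < j + 1 \<and> j + 1 < 2 * int n - k"
          using odds by auto
        moreover have "v \<in> vertices k \<longleftrightarrow> k \<le> j \<and> j \<le> 2 * int n - k"
          unfolding v vertices_def mem_Collect_eq prod.case using row oddij False by auto
        moreover have "\<not> (\<exists>h\<in>{1..s}. \<bar>i - int m\<bar> \<le> k \<and> \<bar>j - y h\<bar> \<le> int (a h) - (k + 1))"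
          using False by force
        then have "v \<in> vertices (k + 1) \<longleftrightarrow> k < j \<and> j < 2 * int n - k"
          unfolding v vertices_def ik mem_Collect_eq prod.case using row oddij by auto
        moreover have "k < j \<and> j < 2 * int n - k \<longleftrightarrow> k + 1 \<le> j \<and> j \<le> 2 * int n - (k + 1)" by linarith
        ultimately show ?thesis using step_two_interval[OF 2(2) kn] by simp
      qed
    qed
    finally show ?thesis .
  next
    case 3
    have "{c \<in> cells k. v \<in> corners c} = {(i - 1, j), (i + 1, j)} \<inter> cells k"
      using 3 by (auto simp: corner cells_def)
    also have "card \<dots> = of_bool ((i - 1, j) \<in> cells k) + of_bool ((i + 1, j) \<in> cells k)"
      by (rule card_pair_Int) simp
    also have "\<dots> = of_bool (v \<in> vertices k) + of_bool (v \<in> vertices (k + 1))"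
    proof -
      have oddij: "odd (i + j)" and odds: "odd (i - 1 + k)" "odd (i + 1 + k)" using 3 by presburger+
      have par_m: "odd (i - int m - k)" using 3 odd_m by presburger
      \<comment> \<open>In columns of this parity the boundary condition \<open>R\<close> and the
        hole condition \<open>Q\<close> are the same for both levels and for centres. Only the rows
        remain: an interval, with a hole if \<open>Q\<close> holds.\<close>
      define R where "R \<longleftrightarrow> k < j \<and> j < 2 * int n - k"
      define Q where "Q \<longleftrightarrow> (\<exists>h\<in>{1..s}. \<bar>j - y h\<bar> < int (a h) - k)"
      have Q_cell: "(\<exists>h\<in>{1..s}. A \<and> \<bar>j - y h\<bar> < int (a h) - k) \<longleftrightarrow> A \<and> Q" for A
        by (auto simp: Q_def)
      have Q_le: "(\<exists>h\<in>{1..s}. A \<and> \<bar>j - y h\<bar> \<le> int (a h) - k) \<longleftrightarrow> A \<and> Q" for A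
      proof -
        have "\<bar>j - y h\<bar> \<le> int (a h) - k \<longleftrightarrow> \<bar>j - y h\<bar> < int (a h) - k" if "h \<in> {1..s}" for h
          using par[OF that] 3 by presburger
        then show ?thesis by (auto simp: Q_def)
      qed
      have Q_le': "(\<exists>h\<in>{1..s}. A \<and> \<bar>j - y h\<bar> \<le> int (a h) - (k + 1)) \<longleftrightarrow> A \<and> Q" for A
      proof -
        have "\<bar>j - y h\<bar> \<le> int (a h) - (k + 1) \<longleftrightarrow> \<bar>j - y h\<bar> < int (a h) - k" for h by linarith
        then show ?thesis by (auto simp: Q_def)
      qed
      have Rle: "k \<le> j \<and> j \<le> 2 * int n - k \<longleftrightarrow> R" "k + 1 \<le> j \<and> j \<le> 2 * int n - (k + 1) \<longleftrightarrow> R"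
        unfolding R_def using 3 by presburger+
      have "v \<in> vertices k \<longleftrightarrow> R \<and> k \<le> i \<and> i \<le> 2 * int m - k \<and> \<not> (\<bar>i - int m\<bar> \<le> k \<and> Q)"
        unfolding v vertices_def mem_Collect_eq prod.case Q_le Rle(1)[symmetric] using oddij by blast
      moreover have "v \<in> vertices (k + 1) \<longleftrightarrow>
          R \<and> k + 1 \<le> i \<and> i \<le> 2 * int m - (k + 1) \<and> \<not> (\<bar>i - int m\<bar> \<le> k + 1 \<and> Q)"
        unfolding v vertices_def mem_Collect_eq prod.case Q_le' Rle(2)[symmetric] using oddij by blast
      moreover have "(i - 1, j) \<in> cells k \<longleftrightarrow>
          R \<and> k < i - 1 \<and> i - 1 < 2 * int m - k \<and> \<not> (\<bar>i - 1 - int m\<bar> \<le> k \<and> Q)"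
        unfolding cells_def mem_Collect_eq prod.case Q_cell R_def using odds 3 by blast
      moreover have "(i + 1, j) \<in> cells k \<longleftrightarrow>
          R \<and> k < i + 1 \<and> i + 1 < 2 * int m - k \<and> \<not> (\<bar>i + 1 - int m\<bar> \<le> k \<and> Q)"
        unfolding cells_def mem_Collect_eq prod.case Q_cell R_def using odds 3 by blast
      ultimately show ?thesis
        using step_two_interval[OF 3(1), of "int m"] step_two_interval_hole[OF 3(1) par_m km k] k km
        by (cases R; cases Q) simp_all
    qed
    finally show ?thesis .
  qed
qed
end

section \<open>Counting and the induction on k\<close>

definition progression :: "int \<Rightarrow> nat \<Rightarrow> int set" where
  "progression x p = {i. x \<le> i \<and> i < x + 2 * int p \<and> even (i - x)}"

lemma card_progression: "card (progression x p) = p"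
proof -
  have "progression x p = (\<lambda>t. x + 2 * int t) ` {..<p}"
  proof (intro equalityI subsetI)
    fix i assume "i \<in> progression x p"
    then have i: "x \<le> i" "i < x + 2 * int p" "even (i - x)" by (auto simp: progression_def)
    then obtain t where "i - x = 2 * t" by blast
    then have "i = x + 2 * int (nat t)" "nat t < p" using i by auto
    then show "i \<in> (\<lambda>t. x + 2 * int t) ` {..<p}" by blast
  qed (auto simp: progression_def)
  then show ?thesis by (simp add: card_image inj_on_def)
qed

lemma progression_subset:
  assumes "x \<le> x'" "x' + 2 * int p' \<le> x + 2 * int p" "even (x' - x)"
  shows "progression x' p' \<subseteq> progression x p"
proof
  fix i assume "i \<in> progression x' p'"
  then have "x' \<le> i" "i < x' + 2 * int p'" "even (i - x')" by (auto simp: progression_def)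
  moreover from this assms(3) have "even (i - x)" by presburger
  ultimately show "i \<in> progression x p" using assms unfolding progression_def by auto
qed

lemma finite_progression: "finite (progression x p)"
  by (rule finite_subset[of _ "{x..x + 2 * int p}"]) (auto simp: progression_def)

lemma card_Times_minus_holes:
  assumes "finite S" "finite T" "finite A" "S' \<subseteq> S" "\<And>h. h \<in> A \<Longrightarrow> U h \<subseteq> T"
    and "\<And>h g. \<lbrakk>h \<in> A; g \<in> A; h \<noteq> g\<rbrakk> \<Longrightarrow> U h \<inter> U g = {}"
  shows "int (card (S \<times> T - (\<Union>h\<in>A. S' \<times> U h))) =
    int (card S) * int (card T) - int (card S') * (\<Sum>h\<in>A. int (card (U h)))"
proof -
  have fin: "finite S'" "\<And>h. h \<in> A \<Longrightarrow> finite (U h)"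
    by (rule finite_subset[OF assms(4,1)], rule finite_subset[OF assms(5,2)])
  have "card (\<Union>h\<in>A. S' \<times> U h) = (\<Sum>h\<in>A. card (S' \<times> U h))"
    using assms(3,6) fin by (intro card_UN_disjoint) auto
  then have "int (card (\<Union>h\<in>A. S' \<times> U h)) = int (card S') * (\<Sum>h\<in>A. int (card (U h)))"
    by (simp add: card_cartesian_product sum_distrib_left)
  moreover have sub: "(\<Union>h\<in>A. S' \<times> U h) \<subseteq> S \<times> T" using assms(4,5) by blast
  moreover have "card (S \<times> T - (\<Union>h\<in>A. S' \<times> U h)) = card (S \<times> T) - card (\<Union>h\<in>A. S' \<times> U h)"
    using assms(3) fin sub by (intro card_Diff_subset) auto
  moreover have "card (\<Union>h\<in>A. S' \<times> U h) \<le> card (S \<times> T)"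
    using assms(1,2) sub by (intro card_mono) auto
  ultimately show ?thesis by (simp add: of_nat_diff card_cartesian_product)
qed

lemma grid_edges_corners:
  "grid_edges \<inter> Pow {(i, j - 1), (i, j + 1), (i - 1, j), (i + 1, j)} =
     {{(i, j - 1), (i - 1, j)}, {(i, j - 1), (i + 1, j)}, {(i, j + 1), (i - 1, j)}, {(i, j + 1), (i + 1, j)}}"
proof (intro equalityI subsetI)
  fix e assume "e \<in> grid_edges \<inter> Pow {(i, j - 1), (i, j + 1), (i - 1, j), (i + 1, j)}"
  then obtain p q where "e = {p, q}" "cell_adj p q"
    "p \<in> {(i, j - 1), (i, j + 1), (i - 1, j), (i + 1, j)}" "q \<in> {(i, j - 1), (i, j + 1), (i - 1, j), (i + 1, j)}"
    by (auto simp: grid_edges_def)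
  then show "e \<in> {{(i, j - 1), (i - 1, j)}, {(i, j - 1), (i + 1, j)}, {(i, j + 1), (i - 1, j)}, {(i, j + 1), (i + 1, j)}}"
    unfolding insert_iff empty_iff by (elim disjE FalseE; simp add: cell_adj_def insert_commute)
next
  have "cell_adj p q \<Longrightarrow> {p, q} \<in> grid_edges" for p q unfolding grid_edges_def by blast
  then show "e \<in> grid_edges \<inter> Pow {(i, j - 1), (i, j + 1), (i - 1, j), (i + 1, j)}"
    if "e \<in> {{(i, j - 1), (i - 1, j)}, {(i, j - 1), (i + 1, j)}, {(i, j + 1), (i - 1, j)}, {(i, j + 1), (i + 1, j)}}" for e
    using that by (auto simp: cell_adj_def)
qed

section \<open>The exponent and the passage to the next level\<close>

context aligned_holes
begin

text \<open>In each of the \<open>m - k\<close> rows of centres, vertices and centres alternate,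
  with one vertex more if holes are ignored. Each hole meets \<open>k + 1\<close> of these rows and
  removes from each one more vertex than centres.\<close>

lemma card_vertices_minus_cells:
  assumes ka: "\<And>h. h \<in> {1..s} \<Longrightarrow> k < a h" and km: "2 * k + 2 < m" and kn: "k < n"
  shows "int (card (vertices (int k) \<inter> {v. odd (fst v + int k)})) - int (card (cells (int k))) =
    int m - int k - int s * (int k + 1)"
proof -
  let ?S = "progression (int k + 1) (m - k)" and ?S' = "progression (int m - int k) (k + 1)"
  let ?U = "\<lambda>h. progression (y h - (int (a h) - int k)) (a h - k + 1)"
  let ?U' = "\<lambda>h. progression (y h - (int (a h) - int k) + 1) (a h - k)"
  have mk: "int (m - k) = int m - int k" using km by linarith
  \<comment> \<open>Since \<open>m\<close> is odd, the hole rows from \<open>m - k\<close> to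
    \<open>m + k\<close> in steps of 2 are rows of centres.\<close>
  have sub: "?S' \<subseteq> ?S"
    using km odd_m by (auto simp: progression_def)
  have row: "i \<in> ?S \<longleftrightarrow> int k \<le> i \<and> i \<le> 2 * int m - int k" "i \<in> ?S' \<longleftrightarrow> \<bar>i - int m\<bar> \<le> int k"
    if "odd (i + int k)" for i
  proof -
    show "i \<in> ?S \<longleftrightarrow> int k \<le> i \<and> i \<le> 2 * int m - int k"
      using that unfolding progression_def mem_Collect_eq mk by presburger
    show "i \<in> ?S' \<longleftrightarrow> \<bar>i - int m\<bar> \<le> int k"
      using that odd_m unfolding progression_def mem_Collect_eq by presburger
  qed
  have rowS: "odd (i + int k)" if "i \<in> ?S" for i using that by (auto simp: progression_def)
  have V: "vertices (int k) \<inter> {v. odd (fst v + int k)} =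
      ?S \<times> progression (int k) (n - k + 1) - (\<Union>h\<in>{1..s}. ?S' \<times> ?U h)" (is "?L = ?R")
  proof (intro set_eqI)
    fix v :: cell
    obtain i j where v: "v = (i, j)" by (cases v)
    show "v \<in> ?L \<longleftrightarrow> v \<in> ?R"
    proof (cases "odd (i + int k) \<and> even (j + int k)")
      case False
      then have "v \<notin> ?L" by (auto simp: v vertices_def)
      moreover have "v \<notin> ?R" using False rowS by (auto simp: v progression_def)
      ultimately show ?thesis by blast
    next
      case True
      have U: "j \<in> ?U h \<longleftrightarrow> \<bar>j - y h\<bar> \<le> int (a h) - int k" if "h \<in> {1..s}" for h
      proof -
        have "even (j - (y h - (int (a h) - int k)))" using True par[OF that] by presburger
        moreover have "int (a h - k + 1) = int (a h) - int k + 1" using ka[OF that] by linarith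
        ultimately show ?thesis unfolding progression_def mem_Collect_eq by presburger
      qed
      have T: "j \<in> progression (int k) (n - k + 1) \<longleftrightarrow> int k \<le> j \<and> j \<le> 2 * int n - int k"
      proof -
        have "int (n - k + 1) = int n - int k + 1" using kn by linarith
        then show ?thesis using True unfolding progression_def mem_Collect_eq by presburger
      qed
      show ?thesis using True U T row by (auto simp: v vertices_def)
    qed
  qed
  have C: "cells (int k) = ?S \<times> progression (int k + 1) (n - k) - (\<Union>h\<in>{1..s}. ?S' \<times> ?U' h)" (is "_ = ?R")
  proof (intro set_eqI)
    fix v :: cell
    obtain i j where v: "v = (i, j)" by (cases v)
    show "v \<in> cells (int k) \<longleftrightarrow> v \<in> ?R"
    proof (cases "odd (i + int k) \<and> odd (j + int k)")
      case False
      then have "v \<notin> cells (int k)" by (auto simp: v cells_def)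
      moreover have "v \<notin> ?R" using False rowS by (auto simp: v progression_def)
      ultimately show ?thesis by blast
    next
      case True
      have U: "j \<in> ?U' h \<longleftrightarrow> \<bar>j - y h\<bar> < int (a h) - int k" if "h \<in> {1..s}" for h
      proof -
        let ?x = "y h - (int (a h) - int k) + 1"
        have ev: "even (j - ?x)" using True par[OF that] by presburger
        then obtain t where t: "j - ?x = 2 * t" by blast
        have d: "int (a h - k) = int (a h) - int k" using ka[OF that] by linarith
        have j: "j = ?x + 2 * t" using t by simp
        have "\<bar>j - y h\<bar> < int (a h) - int k \<longleftrightarrow> 0 \<le> t \<and> t < int (a h) - int k"
          unfolding j by arith
        moreover have "?x \<le> j \<and> j < ?x + 2 * int (a h - k) \<longleftrightarrow> 0 \<le> t \<and> t < int (a h) - int k"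
          unfolding j d by arith
        ultimately show ?thesis using ev unfolding progression_def mem_Collect_eq by blast
      qed
      have T: "j \<in> progression (int k + 1) (n - k) \<longleftrightarrow> int k < j \<and> j < 2 * int n - int k"
      proof -
        have "int (n - k) = int n - int k" using kn by linarith
        then show ?thesis using True unfolding progression_def mem_Collect_eq by presburger
      qed
      have "i \<in> ?S \<longleftrightarrow> int k < i \<and> i < 2 * int m - int k"
        using True unfolding progression_def mem_Collect_eq mk by presburger
      then show ?thesis using True U T row(2) by (auto simp: v cells_def)
    qed
  qed
  have U_sub: "?U h \<subseteq> progression (int k) (n - k + 1)" "?U' h \<subseteq> progression (int k + 1) (n - k)" if "h \<in> {1..s}" for h
  proof -
    have d: "int (a h - k) = int (a h) - int k" "int (n - k) = int n - int k" using ka[OF that] kn by linarith+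
    show "?U h \<subseteq> progression (int k) (n - k + 1)"
    proof (rule progression_subset)
      show "y h - (int (a h) - int k) + 2 * int (a h - k + 1) \<le> int k + 2 * int (n - k + 1)"
        using right[OF that] unfolding of_nat_add d of_nat_1 by (simp add: algebra_simps)
      show "even (y h - (int (a h) - int k) - int k)" using par[OF that] by presburger
    qed (use left[OF that] in linarith)
    show "?U' h \<subseteq> progression (int k + 1) (n - k)"
    proof (rule progression_subset)
      show "y h - (int (a h) - int k) + 1 + 2 * int (a h - k) \<le> int k + 1 + 2 * int (n - k)"
        using right[OF that] unfolding d by (simp add: algebra_simps)
      show "even (y h - (int (a h) - int k) + 1 - (int k + 1))" using par[OF that] by presburger
    qed (use left[OF that] in linarith)
  qed
  have U_bd: "y h - int (a h) \<le> j" "j < y h + int (a h) + 2" if "j \<in> ?U h \<or> j \<in> ?U' h" "h \<in> {1..s}" for j h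
  proof -
    have d: "int (a h - k) = int (a h) - int k" using ka[OF that(2)] by linarith
    show "y h - int (a h) \<le> j" "j < y h + int (a h) + 2"
      using that(1) unfolding progression_def mem_Collect_eq of_nat_add d of_nat_1 by (elim disjE conjE; simp)+
  qed
  have U_disj: "?U h \<inter> ?U g = {}" "?U' h \<inter> ?U' g = {}" if hg: "h \<in> {1..s}" "g \<in> {1..s}" "h \<noteq> g" for h g
  proof -
    have False if "j \<in> ?U h \<or> j \<in> ?U' h" "j \<in> ?U g \<or> j \<in> ?U' g" for j
      using apart[OF hg] U_bd[OF that(1) hg(1)] U_bd[OF that(2) hg(2)] by linarith
    then show "?U h \<inter> ?U g = {}" "?U' h \<inter> ?U' g = {}" by blast+
  qed
  have "int (card (vertices (int k) \<inter> {v. odd (fst v + int k)})) =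
      int (m - k) * int (n - k + 1) - int (k + 1) * (\<Sum>h\<in>{1..s}. int (a h - k + 1))"
    unfolding V by (subst card_Times_minus_holes) (use sub U_sub U_disj in \<open>auto simp: finite_progression card_progression\<close>)
  moreover have "int (card (cells (int k))) =
      int (m - k) * int (n - k) - int (k + 1) * (\<Sum>h\<in>{1..s}. int (a h - k))"
    unfolding C by (subst card_Times_minus_holes) (use sub U_sub U_disj in \<open>auto simp: finite_progression card_progression\<close>)
  moreover have "(\<Sum>h\<in>{1..s}. int (a h - k + 1)) = (\<Sum>h\<in>{1..s}. int (a h - k)) + int s"
    by (simp add: sum.distrib)
  ultimately show ?thesis by (simp add: mk algebra_simps)
qed

lemma matchings_step:
  assumes ka: "\<And>h. h \<in> {1..s} \<Longrightarrow> k < a h" and km: "2 * k + 2 < m" and kn: "k < n"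
  shows "2 ^ card (cells (int k)) * card (matchings grid_edges (vertices (int k))) =
    2 ^ card (vertices (int k) \<inter> {v. odd (fst v + int k)}) * card (matchings grid_edges (vertices (int (Suc k))))"
proof -
  have S: "int (Suc k) = int k + 1" by simp
  show ?thesis
    unfolding S
  proof (rule card_matchings_complementation[where K = corners])
    show "card {c \<in> cells (int k). v \<in> corners c} =
        of_bool (v \<in> vertices (int k)) + of_bool (v \<in> vertices (int k + 1))" for v
      using ka km kn by (intro corner_count) auto
    show "2 * card (matchings grid_edges X) =
        2 ^ card (X \<inter> {v. odd (fst v + int k)}) * card (matchings grid_edges (corners c - X))"
      if c: "c \<in> cells (int k)" and X: "X \<subseteq> corners c" for c X
    proof -
      obtain i j where ij: "c = (i, j)" by (cases c)
      have K: "corners c = {(i, j - 1), (i, j + 1), (i - 1, j), (i + 1, j)}" by (simp add: ij corners_def)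
      \<comment> \<open>The upper and lower corners are in rows of the other parity, so only the
        left and right ones count.\<close>
      have "odd (i + int k)" using c by (simp add: ij cells_def)
      then have "X \<inter> {v. odd (fst v + int k)} = X \<inter> {(i, j - 1), (i, j + 1)}"
        using X unfolding K by auto
      then show ?thesis
        using matchings_four_cycle_complement[OF _ _ _ _ _ _ grid_edges_corners X[unfolded K]] K by simp
    qed
  qed (use cell_of_edge edge_in_unique_cell in \<open>auto simp: finite_cells finite_vertices corners_def\<close>)
qed

end

section \<open>Translation to the graphs of the theorem and conclusion\<close>

lemma num_perfect_matchings_eq_card_matchings:
  "num_perfect_matchings (W, {e \<in> E. e \<subseteq> W}) = card (matchings E W)"
  unfolding num_perfect_matchings_def perfect_matching_def matchings_def
  by (rule arg_cong[of _ _ card]) auto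

lemma induced_aztec_rectangle:
  "induced_subgraph (aztec_rectangle m n) U =
    ({p \<in> board m n. white p} \<inter> U, {e \<in> grid_edges. e \<subseteq> {p \<in> board m n. white p} \<inter> U})"
proof -
  have "{e \<in> {{p, q} | p q. p \<in> V \<and> q \<in> V \<and> cell_adj p q}. e \<subseteq> U} = {e \<in> grid_edges. e \<subseteq> V \<inter> U}" for V
    unfolding grid_edges_def by blast
  from this[of "{p \<in> board m n. white p}"] show ?thesis
    unfolding induced_subgraph_def aztec_rectangle_def Let_def fst_conv snd_conv by (simp only:)
qed

lemma holey_rectangle_eq:
  assumes "aligned_holes m n s a y" "\<And>h. h \<in> {1..s} \<Longrightarrow> \<lfloor>2 * c h - 2\<rfloor> = y h"
    and ka: "\<And>h. h \<in> {1..s} \<Longrightarrow> k \<le> a h"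
  shows "num_perfect_matchings (holey_rectangle m n s a c k) =
    card (matchings grid_edges (aligned_holes.vertices m n s a y (int k)))"
proof -
  interpret aligned_holes m n s a y by fact
  have hole: "(i, j) \<in> odd_aztec_rectangle k (a h - k) (int m, \<lfloor>2 * c h - 2\<rfloor>) \<longleftrightarrow>
      \<bar>i - int m\<bar> \<le> int k \<and> \<bar>j - y h\<bar> \<le> int (a h) - int k" if h: "h \<in> {1..s}" and ij: "odd (i + j)" for h i j
  proof -
    have "(i, j) \<in> odd_aztec_rectangle k (a h - k) (int m, \<lfloor>2 * c h - 2\<rfloor>) \<longleftrightarrow>
      \<bar>i - int m\<bar> \<le> int k \<and> \<bar>j - y h\<bar> \<le> int (a h - k) \<and>
      (i - int m + (j - y h)) mod 2 = (int k + int (a h - k)) mod 2"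
      (is "?L \<longleftrightarrow> ?R")
    proof
      assume ?L
      then obtain r t where "i = int m + r" "j = y h + t" "\<bar>r\<bar> \<le> int k" "\<bar>t\<bar> \<le> int (a h - k)"
        "(r + t) mod 2 = (int k + int (a h - k)) mod 2"
        unfolding odd_aztec_rectangle_def assms(2)[OF h] by auto
      then show ?R by simp
    next
      assume ?R
      moreover have "(i, j) = (fst (int m, y h) + (i - int m), snd (int m, y h) + (j - y h))" by simp
      ultimately show ?L unfolding odd_aztec_rectangle_def assms(2)[OF h] by blast
    qed
    \<comment> \<open>The parity condition is automatic: \<open>i + j\<close> and \<open>m\<close>
      are odd and \<open>y h\<close> has the parity of \<open>a h\<close>.\<close>
    moreover have "(i - int m + (j - y h)) mod 2 = (int k + int (a h - k)) mod 2"
    proof -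
      have "int k + int (a h - k) = int (a h)" using ka[OF h] by linarith
      then show ?thesis using ij par[OF h] odd_m by presburger
    qed
    ultimately show ?thesis using ka[OF h] by (simp add: of_nat_diff)
  qed
  have "{p \<in> board m n. white p} \<inter>
      ({int k..2 * int m - int k} \<times> {int k..2 * int n - int k} -
       (\<Union>h\<in>{1..s}. odd_aztec_rectangle k (a h - k) (int m, \<lfloor>2 * c h - 2\<rfloor>))) = vertices (int k)"
    using hole by (auto simp: board_def white_def vertices_def)
  then show ?thesis
    unfolding holey_rectangle_def induced_aztec_rectangle
    by (simp only: num_perfect_matchings_eq_card_matchings)
qed

theorem theorem3p3:
  fixes m n s k :: nat and a :: "nat \<Rightarrow> nat" and c :: "nat \<Rightarrow> real"
  assumes "m > 0" and "odd m"
    and "s \<ge> 1"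
    and "int n = int m - (\<Sum>i = 1..s. (int (a i) + 1))" and "n \<ge> 1"
    and "\<And>i. i \<in> {1..s} \<Longrightarrow> 2 * c i \<in> \<int>"
    and "\<And>i. i \<in> {1..s} \<Longrightarrow> c i - real (a i) / 2 \<in> \<int>"
    and "disjoint_family_on (\<lambda>i. centered_block (c i) (a i)) {1..s}"
    and "\<And>i. i \<in> {1..s} \<Longrightarrow> centered_block (c i) (a i) \<subseteq> {1..int n + 1}"
    and "1 \<le> k" and "k \<le> Min (a ` {1..s})"
  shows "real (num_perfect_matchings (holey_rectangle m n s a c k)) =
    2 powi (int ((k + 1) choose 2) * (int s + 1) - int k * (int m + 1)) *
    real (num_perfect_matchings (holey_rectangle m n s a c 0))"
proof -
  \<comment> \<open>\<open>z h\<close> is the least element of the block \<open>h\<close>, and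
    \<open>2 * z h - 2\<close> is the column of the first deleted cell.\<close>
  define z where "z h = \<lfloor>c h - real (a h) / 2\<rfloor>" for h
  define y where "y h = 2 * z h + int (a h) - 2" for h
  have c: "c h = of_int (z h) + real (a h) / 2" if "h \<in> {1..s}" for h
    using assms(7)[OF that] by (auto simp: z_def elim!: Ints_cases)
  have block: "centered_block (c h) (a h) = {z h..z h + int (a h)}" if "h \<in> {1..s}" for h
    unfolding centered_block_def c[OF that] by auto
  have fl: "\<lfloor>2 * c h - 2\<rfloor> = y h" if "h \<in> {1..s}" for h
  proof -
    have "2 * c h - 2 = of_int (y h)" unfolding c[OF that] y_def by simp
    then show ?thesis by simp
  qed
  have z: "1 \<le> z h" "z h + int (a h) \<le> int n + 1" if "h \<in> {1..s}" for h
    using assms(9)[OF that] unfolding block[OF that] by auto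
  have zdisj: "z h + int (a h) < z g \<or> z g + int (a g) < z h" if "h \<in> {1..s}" "g \<in> {1..s}" "h \<noteq> g" for h g
  proof -
    have "{z h..z h + int (a h)} \<inter> {z g..z g + int (a g)} = {}"
      using assms(8) that block by (auto simp: disjoint_family_on_def)
    \<comment> \<open>If two blocks overlapped, the larger of their least elements would lie in
      both.\<close>
    then have "max (z h) (z g) \<notin> {z h..z h + int (a h)} \<inter> {z g..z g + int (a g)}" by blast
    then show ?thesis by (auto simp: max_def split: if_splits)
  qed
  interpret aligned_holes m n s a y
  proof
    show "int (a h) + int (a g) + 2 \<le> \<bar>y h - y g\<bar>" if "h \<in> {1..s}" "g \<in> {1..s}" "h \<noteq> g" for h g
      using zdisj[OF that] unfolding y_def by linarith
    show "y h + int (a h) \<le> 2 * int n" "int (a h) \<le> y h" if "h \<in> {1..s}" for h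
      using z[OF that] unfolding y_def by linarith+
  qed (use assms(2) in \<open>auto simp: y_def\<close>)
  have ka: "k \<le> a h" if "h \<in> {1..s}" for h using assms(11) that by auto
  \<comment> \<open>A block with \<open>a 1 + 1\<close> elements fits into
    \<open>{1..n + 1}\<close>, so \<open>a 1 \<le> n\<close>. Hence
    \<open>m \<ge> n + a 1 + 1 \<ge> 2 * k + 1\<close>, which exceeds \<open>2 * j + 2\<close> for
    \<open>j < k\<close>.\<close>
  have sizes: "j < n" "2 * j + 2 < m" if "j < k" for j
  proof -
    have 1: "1 \<in> {1..s}" using assms(3) by simp
    have "a 1 \<le> n" using z[OF 1] by linarith
    then show "j < n" using ka[OF 1] that by linarith
    have "int (a 1) + 1 \<le> (\<Sum>i = 1..s. (int (a i) + 1))"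
      using 1 by (intro member_le_sum) auto
    then have "n + a 1 + 1 \<le> m" using assms(4) by linarith
    then show "2 * j + 2 < m" using \<open>a 1 \<le> n\<close> ka[OF 1] that by linarith
  qed
  let ?M = "\<lambda>j. real (card (matchings grid_edges (vertices (int j))))"
  have "?M j = 2 powi (int ((j + 1) choose 2) * (int s + 1) - int j * (int m + 1)) * ?M 0" if "j \<le> k" for j
    using that
  proof (induction j)
    case 0
    then show ?case by (simp add: binomial_eq_0)
  next
    case (Suc j)
    have lt: "j < a h" if "h \<in> {1..s}" for h using ka[OF that] Suc.prems by simp
    have sz: "2 * j + 2 < m" "j < n" using sizes Suc.prems by simp_all
    let ?C = "card (cells (int j))" and ?V = "card (vertices (int j) \<inter> {v. odd (fst v + int j)})"
    have "real (2 ^ ?C * card (matchings grid_edges (vertices (int j)))) =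
        real (2 ^ ?V * card (matchings grid_edges (vertices (int (Suc j)))))"
      using matchings_step[OF lt sz] by (simp only:)
    then have "2 powi int ?C * ?M j = 2 powi int ?V * ?M (Suc j)" by simp
    then have "?M (Suc j) = 2 powi (int ?C - int ?V) * ?M j"
      by (simp add: power_int_diff field_simps)
    also have "int ?C - int ?V = int s * (int j + 1) - (int m - int j)"
      using card_vertices_minus_cells[OF lt sz] by simp
    also have "?M j = 2 powi (int ((j + 1) choose 2) * (int s + 1) - int j * (int m + 1)) * ?M 0"
      using Suc by simp
    also have "2 powi (int s * (int j + 1) - (int m - int j)) *
        (2 powi (int ((j + 1) choose 2) * (int s + 1) - int j * (int m + 1)) * ?M 0) =
        2 powi (int s * (int j + 1) - (int m - int j) + (int ((j + 1) choose 2) * (int s + 1) - int j * (int m + 1))) * ?M 0"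
      by (simp add: power_int_add)
    also have "int s * (int j + 1) - (int m - int j) + (int ((j + 1) choose 2) * (int s + 1) - int j * (int m + 1)) =
        int ((Suc j + 1) choose 2) * (int s + 1) - int (Suc j) * (int m + 1)"
    proof -
      \<comment> \<open>By Pascal's rule the exponent grows by
        \<open>(j + 1) * (s + 1) - (m + 1)\<close>, which equals
        \<open>s * (j + 1) - (m - j)\<close>.\<close>
      have "(Suc j + 1) choose 2 = ((j + 1) choose 2) + (j + 1)" by (simp add: numeral_2_eq_2)
      then show ?thesis by (simp add: algebra_simps)
    qed
    finally show ?case .
  qed
  then show ?thesis
    using holey_rectangle_eq[OF aligned_holes_axioms fl] ka by simp
qed

end
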